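(* There is an absolute constant $c>0$ such that for all sufficiently large $n$ there is a probability distribution over instances (sequences of $2n$ insertions, exactly $n$ of which increment $p$ and $n$ of which increment $q$, starting from $p=q=0$) such that for every family of bijections $(f_{p,q})$, the expected total cost over a random instance from this distribution is at least $c\, n\log n/\log\log n$; i.e., the expected amortized cost per insertion is $\Omega(\log n/\log\log n)$.
   Context: Balls-to-bins problem: the state is $(p,q)$; there are balls $a_1,\dots,a_p,b_1,\dots,b_q$ and bins $1,\dots,p+q$, and the placement is a bijection $f_{p,q}$ from balls to bins depending only on $(p,q)$. An insertion increments $p$ (creating ball $a_{p+1}$) or $q$ (creating ball $b_{q+1}$) together with a new bin, and the placement switches to the new bijection. The cost of an insertion is the number of balls whose bin changes (relocated balls). This is the special case of the two-way adapter problem where only allocations occur. *)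

theory Defs
  imports "HOL-Probability.Probability"
begin

text \<open>Balls: Inl i is ball a_(i+1) (i < p), Inr j is ball b_(j+1) (j < q).
  Bins: 1..p+q.\<close>

definition balls :: "nat \<Rightarrow> nat \<Rightarrow> (nat + nat) set" where
  "balls p q = Inl ` {..<p} \<union> Inr ` {..<q}"

definition valid_family :: "(nat \<Rightarrow> nat \<Rightarrow> (nat + nat) \<Rightarrow> nat) \<Rightarrow> bool" where
  "valid_family f \<longleftrightarrow> (\<forall>p q. bij_betw (f p q) (balls p q) {1..p+q})"

text \<open>An instance is a list of insertions: True increments p, False increments q.
  State after the first k insertions.\<close>
definition state :: "bool list \<Rightarrow> nat \<Rightarrow> nat \<times> nat" where
  "state xs k = (length (filter id (take k xs)), length (filter Not (take k xs)))"

definition valid_instance :: "nat \<Rightarrow> bool list \<Rightarrow> bool" where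
  "valid_instance n xs \<longleftrightarrow> length xs = 2 * n \<and> length (filter id xs) = n"

definition step_cost :: "(nat \<Rightarrow> nat \<Rightarrow> (nat + nat) \<Rightarrow> nat) \<Rightarrow> nat \<times> nat \<Rightarrow> nat \<times> nat \<Rightarrow> nat" where
  "step_cost f s s' = card {x \<in> balls (fst s) (snd s). f (fst s') (snd s') x \<noteq> f (fst s) (snd s) x}"

definition total_cost :: "(nat \<Rightarrow> nat \<Rightarrow> (nat + nat) \<Rightarrow> nat) \<Rightarrow> bool list \<Rightarrow> nat" where
  "total_cost f xs = (\<Sum>k<length xs. step_cost f (state xs k) (state xs (Suc k)))"

end

theory Submission
  imports Defs "HOL-Real_Asymp.Real_Asymp"
begin

text \<open>
  For states \<open>s \<le> s'\<close> let \<open>D(s, s')\<close> be the number of balls present in \<open>s\<close> whose bins differ in \<open>s\<close> and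
  \<open>s'\<close>. A window from \<open>s\<close> to \<open>s'\<close> is cut into \<open>32 L\<close> equally long subwindows, with the fraction of
  \<open>a\<close>-insertions raised by \<open>1/(8L)\<close> in the first half and lowered by \<open>1/(8L)\<close> in the second half, or
  the other way round, according to a fair coin; this is iterated for \<open>L\<close> levels, so the fraction
  never leaves \<open>[3/8, 5/8]\<close>. The claim is that the sum of \<open>D\<close> over the subwindows exceeds \<open>D(s, s')\<close>, in
  expectation, by a constant fraction of the window length. Summing over the levels gives
  cost of order \<open>L\<close> per insertion, where the window length \<open>8L (32L)^L \<le> n\<close> allows \<open>L\<close> of order
  \<open>log n / log log n\<close>.

  For the claim, start at a new ball \<open>x\<close> of the window, go to its bin in \<open>s'\<close>; if that bin is old, go to
  the ball it held in \<open>s\<close>, then to the bin of that ball in \<open>s'\<close>, and so on until a new bin \<open>\<phi>(x)\<close> is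
  reached. These chains are disjoint and depend on \<open>s\<close> and \<open>s'\<close> only. If at the end of some subwindow
  exactly one of \<open>x\<close> and \<open>\<phi>(x)\<close> exists, then somewhere on the chain a ball sits in a bin that is neither its
  initial nor its final one, which costs one relocation beyond \<open>D(s, s')\<close>. The creation time of \<open>\<phi>(x)\<close>
  does not depend on the coin, whereas for a constant fraction of the \<open>x\<close> the two values of the
  coin create \<open>x\<close> in different subwindows, so one of the two outcomes has to pay.
\<close>

section \<open>Detours in a growing family of bijections\<close>

text \<open>With \<open>h\<close> the initial placement of the old balls \<open>A\<close> and \<open>h'\<close> the final placement of all balls \<open>A'\<close>,
  each ball is linked to the old ball that it displaces.\<close>

definition links :: "'a set \<Rightarrow> 'a set \<Rightarrow> ('a \<Rightarrow> 'b) \<Rightarrow> ('a \<Rightarrow> 'b) \<Rightarrow> ('a \<times> 'a) set" where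
  "links A A' h h' = {(y, y'). y \<in> A' \<and> y' \<in> A \<and> h y' = h' y}"

lemma links_rtrancl_in:
  assumes "(x, y) \<in> (links A A' h h')\<^sup>*" "x \<in> A'" "A \<subseteq> A'"
  shows "y \<in> A'"
  using assms by (induction rule: rtrancl_induct) (auto simp: links_def)

text \<open>Makes chains of different new balls disjoint: as \<open>h'\<close> is injective, links
  can be followed backwards in only one way, and a ball outside \<open>A\<close> has no
  predecessor.\<close>

lemma links_rtrancl_source_unique:
  assumes "(x, y) \<in> (links A A' h h')\<^sup>*" "(x', y) \<in> (links A A' h h')\<^sup>*"
    and "x \<notin> A" "x' \<notin> A" "inj_on h' A'"
  shows "x = x'"
  using assms(1,2)
proof (induction rule: rtrancl_induct)
  case base
  then show ?case
    using assms(3) by (auto elim: rtranclE simp: links_def)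
next
  case (step y z)
  from step.prems show ?case
  proof (cases rule: rtranclE)
    case base
    with step.hyps(2) assms(4) show ?thesis by (auto simp: links_def)
  next
    case (step w)
    have "w = y"
      using step(2) \<open>(y, z) \<in> links A A' h h'\<close> assms(5) by (auto simp: links_def inj_on_def)
    with step(1) \<open>(x', y) \<in> (links A A' h h')\<^sup>* \<Longrightarrow> x = x'\<close> show ?thesis by blast
  qed
qed

text \<open>Otherwise every ball reachable from \<open>x\<close> has a successor, and the successor
  map injects the finite reachable set into itself minus \<open>x\<close>, since \<open>x\<close> is
  not in \<open>A\<close>.\<close>

lemma links_reach_new:
  assumes "finite A'" "A \<subseteq> A'" "bij_betw h A B" "inj_on h' A'" "x \<in> A' - A"
  shows "\<exists>y. (x, y) \<in> (links A A' h h')\<^sup>* \<and> h' y \<notin> B"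
proof (rule ccontr)
  assume "\<not> ?thesis"
  then have old: "h' y \<in> B" if "(x, y) \<in> (links A A' h h')\<^sup>*" for y using that by blast
  define S where "S = {y. (x, y) \<in> (links A A' h h')\<^sup>*}"
  have SA: "S \<subseteq> A'"
    using links_rtrancl_in[of x _ A A' h h'] assms(2,5) by (auto simp: S_def)
  then have finS: "finite S" using assms(1) finite_subset by blast
  define nx where "nx y = inv_into A h (h' y)" for y
  have nx: "nx y \<in> A" "h (nx y) = h' y" if "y \<in> S" for y
    using old[of y] that assms(3)
    by (auto simp: nx_def S_def bij_betw_def inv_into_into f_inv_into_f)
  have "nx ` S \<subseteq> S - {x}"
  proof
    fix z assume "z \<in> nx ` S"
    then obtain y where y: "y \<in> S" "z = nx y" by blast
    then have "(y, z) \<in> links A A' h h'" using nx[of y] SA by (auto simp: links_def)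
    with y nx[of y] assms(5) show "z \<in> S - {x}" by (auto simp: S_def)
  qed
  moreover have "inj_on nx S"
    using nx SA assms(4) by (metis (no_types, lifting) inj_on_def subsetD)
  ultimately have "card S \<le> card (S - {x})"
    using finS by (metis card_inj_on_le finite_Diff)
  moreover have "x \<in> S" by (simp add: S_def)
  ultimately show False using finS by (metis card_Diff1_less not_less)
qed

section \<open>Relocations beyond the net displacement, counted by visited bins\<close>

locale growing_bijections =
  fixes X :: "nat \<Rightarrow> 'a set" and Y :: "nat \<Rightarrow> 'b set" and g :: "nat \<Rightarrow> 'a \<Rightarrow> 'b" and n :: nat
  assumes fin: "finite (X n)"
    and X_mono: "\<And>s t. s \<le> t \<Longrightarrow> t \<le> n \<Longrightarrow> X s \<subseteq> X t"
    and Y_mono: "\<And>s t. s \<le> t \<Longrightarrow> t \<le> n \<Longrightarrow> Y s \<subseteq> Y t"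
    and bij: "\<And>t. t \<le> n \<Longrightarrow> bij_betw (g t) (X t) (Y t)"
begin

text \<open>Pairs of ball and bin, not of ball and time: a bin revisited by the same ball counts
  once. The birth bin of a new ball counts unless it is its final bin.\<close>

definition detours :: "('a \<times> 'b) set" where
  "detours = {(y, z). y \<in> X n \<and> (\<exists>t\<le>n. y \<in> X t \<and> g t y = z) \<and> z \<noteq> g n y
     \<and> \<not> (y \<in> X 0 \<and> z = g 0 y)}"

lemma finX: "t \<le> n \<Longrightarrow> finite (X t)"
  using fin X_mono finite_subset by blast

lemma finite_detours: "finite detours"
proof -
  have "detours \<subseteq> X n \<times> Y n"
    using bij Y_mono by (fastforce simp: detours_def bij_betw_def)
  moreover have "finite (Y n)" using bij fin bij_betw_finite by blast
  ultimately show ?thesis using fin finite_subset by blast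
qed

lemma card_visited_le:
  assumes "y \<in> X n"
  shows "card {g t y |t. t \<le> n \<and> y \<in> X t} \<le> Suc (card {i. i < n \<and> y \<in> X i \<and> g (Suc i) y \<noteq> g i y})"
proof -
  define b where "b = (LEAST t. y \<in> X t)"
  have b: "y \<in> X b" "b \<le> n" and bl: "\<And>t. y \<in> X t \<Longrightarrow> b \<le> t"
    unfolding b_def using assms by (auto intro: LeastI Least_le)
  define C where "C = {i. i < n \<and> y \<in> X i \<and> g (Suc i) y \<noteq> g i y}"
  have *: "g t y \<in> insert (g b y) ((\<lambda>i. g (Suc i) y) ` C)" if "b \<le> t" "t \<le> n" for t
    using that
  proof (induction t rule: dec_induct)
    case base
    then show ?case by simp
  next
    case (step t)
    have "y \<in> X t" using X_mono[of b t] step b by auto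
    then show ?case
      using step by (cases "g (Suc t) y = g t y") (auto simp: C_def)
  qed
  have "finite C" by (simp add: C_def)
  have "card {g t y |t. t \<le> n \<and> y \<in> X t} \<le> card (insert (g b y) ((\<lambda>i. g (Suc i) y) ` C))"
    using * bl \<open>finite C\<close> by (intro card_mono) auto
  also have "\<dots> \<le> Suc (card ((\<lambda>i. g (Suc i) y) ` C))"
    by (rule card_insert_le_m1) auto
  also have "\<dots> \<le> Suc (card C)" using \<open>finite C\<close> by (simp add: card_image_le)
  finally show ?thesis by (simp add: C_def)
qed

text \<open>A ball seen in \<open>k\<close> bins moves at least \<open>k - 1\<close> times. Besides
  its detours it is seen in its final bin and, if old and finally displaced, in its initial
  bin.\<close>

lemma detours_at:
  assumes "y \<in> X n"
  shows "card {z. (y, z) \<in> detours} + (if y \<in> X 0 \<and> g n y \<noteq> g 0 y then 1 else 0)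
    \<le> card {i. i < n \<and> y \<in> X i \<and> g (Suc i) y \<noteq> g i y}"
proof -
  define V where "V = {g t y |t. t \<le> n \<and> y \<in> X t}"
  define P where "P = {z. (y, z) \<in> detours}"
  have finV: "finite V"
  proof -
    have "V \<subseteq> (\<lambda>t. g t y) ` {..n}" by (auto simp: V_def)
    then show ?thesis using finite_subset by blast
  qed
  have PV: "P \<subseteq> V" by (auto simp: P_def V_def detours_def)
  then have finP: "finite P" using finV finite_subset by blast
  have n: "g n y \<in> V" "g n y \<notin> P" using assms by (auto simp: V_def P_def detours_def)
  have "Suc (card P + (if y \<in> X 0 \<and> g n y \<noteq> g 0 y then 1 else 0)) \<le> card V"
  proof (cases "y \<in> X 0 \<and> g n y \<noteq> g 0 y")
    case True
    then have "g 0 y \<in> V" "g 0 y \<notin> P" by (auto simp: V_def P_def detours_def)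
    then have "card (insert (g 0 y) (insert (g n y) P)) \<le> card V"
      using n PV finV by (intro card_mono) auto
    moreover have "card (insert (g 0 y) (insert (g n y) P)) = Suc (Suc (card P))"
      using True n finP \<open>g 0 y \<notin> P\<close> by (subst card_insert_disjoint) auto
    ultimately show ?thesis using True by simp
  next
    case False
    have "card (insert (g n y) P) \<le> card V"
      using n PV finV by (intro card_mono) auto
    moreover have "card (insert (g n y) P) = Suc (card P)" using n finP by simp
    ultimately show ?thesis using False by (simp only: if_False add_0_right)
  qed
  with card_visited_le[OF assms] show ?thesis by (simp add: V_def P_def)
qed

lemma sum_changes_ge:
  "card detours + card {x \<in> X 0. g n x \<noteq> g 0 x} \<le> (\<Sum>i<n. card {x \<in> X i. g (Suc i) x \<noteq> g i x})"
proof -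
  have "detours = (SIGMA y:X n. {z. (y, z) \<in> detours})" by (auto simp: detours_def)
  then have "card detours = card (SIGMA y:X n. {z. (y, z) \<in> detours})" by simp
  also have "\<dots> = (\<Sum>y\<in>X n. card {z. (y, z) \<in> detours})"
  proof (rule card_SigmaI)
    show "\<forall>y\<in>X n. finite {z. (y, z) \<in> detours}"
      using finite_detours finite_subset[of "{z. (y, z) \<in> detours}" "snd ` detours" for y] by force
  qed (rule fin)
  finally have 1: "card detours = (\<Sum>y\<in>X n. card {z. (y, z) \<in> detours})" .
  have "card {x \<in> X 0. g n x \<noteq> g 0 x} = card {x \<in> X n. x \<in> X 0 \<and> g n x \<noteq> g 0 x}"
    using X_mono[of 0 n] by (intro arg_cong[where f = card]) auto
  also have "\<dots> = (\<Sum>y\<in>X n. if y \<in> X 0 \<and> g n y \<noteq> g 0 y then 1 else 0)"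
    using fin by (simp add: sum.If_cases Int_def)
  finally have 2: "card {x \<in> X 0. g n x \<noteq> g 0 x}
      = (\<Sum>y\<in>X n. if y \<in> X 0 \<and> g n y \<noteq> g 0 y then 1 else 0)" .
  have 3: "card {x \<in> X i. g (Suc i) x \<noteq> g i x}
      = (\<Sum>y\<in>X n. if y \<in> X i \<and> g (Suc i) y \<noteq> g i y then 1 else 0)" if "i < n" for i
  proof -
    have "card {x \<in> X i. g (Suc i) x \<noteq> g i x} = card {x \<in> X n. x \<in> X i \<and> g (Suc i) x \<noteq> g i x}"
      using X_mono[of i n] that by (intro arg_cong[where f = card]) auto
    then show ?thesis using fin by (simp add: sum.If_cases Int_def)
  qed
  have 4: "card {i. i < n \<and> y \<in> X i \<and> g (Suc i) y \<noteq> g i y}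
      = (\<Sum>i<n. if y \<in> X i \<and> g (Suc i) y \<noteq> g i y then 1 else 0)" for y
    by (simp add: sum.If_cases Int_def)
  have "card detours + card {x \<in> X 0. g n x \<noteq> g 0 x}
      \<le> (\<Sum>y\<in>X n. card {i. i < n \<and> y \<in> X i \<and> g (Suc i) y \<noteq> g i y})"
    unfolding 1 2 sum.distrib[symmetric] by (intro sum_mono detours_at)
  also have "\<dots> = (\<Sum>i<n. card {x \<in> X i. g (Suc i) x \<noteq> g i x})"
    unfolding 4 by (subst sum.swap) (simp add: 3)
  finally show ?thesis .
qed

abbreviation chain :: "('a \<times> 'a) set" where
  "chain \<equiv> (links (X 0) (X n) (g 0) (g n))\<^sup>*"

text \<open>If the head of a chain exists at time \<open>t\<close> but its final bin does not, then following the chain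
  some ball must sit neither in its initial nor in its final bin.\<close>

lemma detour_ball:
  assumes "(x, y) \<in> chain" "x \<in> X n - X 0" "t \<le> n" "x \<in> X t" "g n y \<notin> Y t"
  shows "\<exists>y'. (x, y') \<in> chain \<and> (y', g t y') \<in> detours"
proof (rule ccontr)
  assume no: "\<not> ?thesis"
  \<comment> \<open>Carried along the chain: the old ball \<open>z\<close> finds its initial bin
    taken by its predecessor, so without a detour it already sits in its final bin.\<close>
  have "y \<in> X t \<and> g t y = g n y"
    using assms(1)
  proof (induction rule: rtrancl_induct)
    case base
    then show ?case using no assms by (auto simp: detours_def)
  next
    case (step y z)
    then have z: "z \<in> X 0" "g 0 z = g n y" "y \<in> X n" by (auto simp: links_def)
    have zt: "z \<in> X t" "z \<in> X n" using z X_mono[of 0 t] X_mono[of 0 n] assms(3) by auto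
    have "z \<noteq> y \<or> g t z = g n z" using step.IH by auto
    moreover have "g t z \<noteq> g 0 z" if "z \<noteq> y"
      using that step.IH zt z bij[OF assms(3)] by (auto simp: bij_betw_def inj_on_def)
    ultimately show ?case
      using no step.hyps zt assms(3) by (auto simp: detours_def intro: rtrancl_into_rtrancl)
  qed
  then have "g n y \<in> g t ` X t" by (metis image_eqI)
  with assms(3,5) bij[of t] show False by (simp add: bij_betw_def)
qed

text \<open>Conversely, if the final bin exists but the head does not, then some bin of the chain holds
  neither its initial nor its final ball.\<close>

lemma detour_bin:
  assumes "(x, y) \<in> chain" "x \<in> X n - X 0" "t \<le> n" "x \<notin> X t" "g n y \<in> Y t" "g n y \<notin> Y 0"
  shows "\<exists>y' w. (x, y') \<in> chain \<and> (w, g n y') \<in> detours"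
proof (rule ccontr)
  assume no: "\<not> ?thesis"
  \<comment> \<open>Without detours into bins of the chain, the ball in such a bin at time
    \<open>t\<close> is its final ball or its initial one.\<close>
  have occ: "w = u \<or> w \<in> X 0 \<and> g 0 w = g t w"
    if "w \<in> X t" "(x, u) \<in> chain" "g t w = g n u" "u \<in> X n" for w u
  proof (rule ccontr)
    assume a: "\<not> ?thesis"
    have "w \<in> X n" using that X_mono assms(3) by blast
    moreover have "g n w \<noteq> g n u" using a that \<open>w \<in> X n\<close> bij[of n] by (auto simp: bij_betw_def inj_on_def)
    ultimately have "(w, g n u) \<in> detours"
      using a that assms(3) by (auto simp: detours_def)
    with no that show False by blast
  qed
  \<comment> \<open>Invariant: \<open>y\<close> is not in its final bin. If that bin is old, its
    occupant must be its initial ball \<open>z\<close>, which is thus not in its own final bin. At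
    the end of the chain the bin is new and has no initial ball.\<close>
  have "y \<in> X n \<and> \<not> (y \<in> X t \<and> g t y = g n y)"
    using assms(1)
  proof (induction rule: rtrancl_induct)
    case base
    then show ?case using assms by auto
  next
    case (step y z)
    then have z: "z \<in> X 0" "g 0 z = g n y" "y \<in> X n" by (auto simp: links_def)
    have zt: "z \<in> X t" "z \<in> X n" using z X_mono[of 0 t] X_mono[of 0 n] assms(3) by auto
    have "g 0 z \<in> Y 0" using z(1) bij[of 0] by (auto simp: bij_betw_def)
    then have "g 0 z \<in> Y t" using Y_mono[of 0 t] assms(3) by auto
    then obtain w where w: "w \<in> X t" "g t w = g n y"
      using bij[OF assms(3)] z by (metis bij_betw_imp_surj_on imageE)
    from occ[OF w(1) step.hyps(1) w(2) z(3)] step.IH w have "w \<in> X 0" "g 0 w = g t w" by auto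
    then have "w = z" using z w bij[of 0] by (auto simp: bij_betw_def inj_on_def)
    show ?case
    proof (intro conjI notI)
      assume "z \<in> X t \<and> g t z = g n z"
      then have "g n z = g n y" using w \<open>w = z\<close> by auto
      then have "z = y" using zt z bij[of n] by (auto simp: bij_betw_def inj_on_def)
      with step.IH \<open>z \<in> X t \<and> g t z = g n z\<close> show False by auto
    qed (rule zt)
  qed
  moreover obtain w where w: "w \<in> X t" "g t w = g n y"
    using bij[OF assms(3)] assms(5) by (metis bij_betw_imp_surj_on imageE)
  ultimately have "w \<in> X 0" "g 0 w = g n y"
    using occ[OF w(1) assms(1) w(2)] by auto
  then have "g n y \<in> g 0 ` X 0" by (metis image_eqI)
  then show False using assms(6) bij[of 0] by (simp add: bij_betw_def)
qed

text \<open>The two kinds of mismatch inject into \<open>detours\<close> separately: if the head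
  comes first, the ball of the detour determines the chain; if the final bin comes first, the bin
  does.\<close>

lemma mismatched_le_detours:
  assumes "\<And>x. x \<in> X n - X 0 \<Longrightarrow> (x, e x) \<in> chain \<and> g n (e x) \<notin> Y 0"
  shows "card {x \<in> X n - X 0. \<exists>t\<le>n. (x \<in> X t) \<noteq> (g n (e x) \<in> Y t)} \<le> 2 * card detours"
proof -
  define T1 where "T1 = {x \<in> X n - X 0. \<exists>t\<le>n. x \<in> X t \<and> g n (e x) \<notin> Y t}"
  define T2 where "T2 = {x \<in> X n - X 0. \<exists>t\<le>n. x \<notin> X t \<and> g n (e x) \<in> Y t}"
  have inj: "inj_on (g n) (X n)" using bij[of n] by (simp add: bij_betw_def)
  note uniq = links_rtrancl_source_unique[OF _ _ _ _ inj]
  have "\<exists>d\<in>detours. (x, fst d) \<in> chain" if "x \<in> T1" for x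
  proof -
    from that obtain t where "x \<in> X n - X 0" "t \<le> n" "x \<in> X t" "g n (e x) \<notin> Y t"
      by (auto simp: T1_def)
    then obtain y where "(x, y) \<in> chain" "(y, g t y) \<in> detours"
      using detour_ball assms by blast
    then show ?thesis by (metis fst_conv)
  qed
  then obtain d1 where d1: "\<And>x. x \<in> T1 \<Longrightarrow> d1 x \<in> detours \<and> (x, fst (d1 x)) \<in> chain"
    by metis
  have "inj_on d1 T1"
  proof (rule inj_onI)
    fix x x' assume "x \<in> T1" "x' \<in> T1" "d1 x = d1 x'"
    with d1[of x] d1[of x'] uniq[of x "fst (d1 x)" _ _ x'] show "x = x'" by (auto simp: T1_def)
  qed
  then have c1: "card T1 \<le> card detours"
    using d1 finite_detours by (intro card_inj_on_le) auto
  have "\<exists>d y. d \<in> detours \<and> (x, y) \<in> chain \<and> snd d = g n y" if "x \<in> T2" for x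
  proof -
    from that obtain t where "x \<in> X n - X 0" "t \<le> n" "x \<notin> X t" "g n (e x) \<in> Y t"
      by (auto simp: T2_def)
    then obtain y w where "(x, y) \<in> chain" "(w, g n y) \<in> detours"
      using detour_bin assms by blast
    then show ?thesis by (metis snd_conv)
  qed
  then obtain d2 y2 where d2:
    "\<And>x. x \<in> T2 \<Longrightarrow> d2 x \<in> detours \<and> (x, y2 x) \<in> chain \<and> snd (d2 x) = g n (y2 x)"
    by metis
  have "inj_on d2 T2"
  proof (rule inj_onI)
    fix x x' assume a: "x \<in> T2" "x' \<in> T2" "d2 x = d2 x'"
    have "y2 x \<in> X n" if "x \<in> T2" for x
      using d2[OF that] links_rtrancl_in[of x "y2 x" "X 0" "X n" "g 0" "g n"] X_mono[of 0 n] that by (simp add: T2_def)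
    then have "y2 x \<in> X n" "y2 x' \<in> X n" using a by auto
    moreover have "g n (y2 x) = g n (y2 x')" using d2 a by metis
    ultimately have "y2 x = y2 x'" using inj by (auto simp: inj_on_def)
    with d2[of x] d2[of x'] uniq[of x "y2 x" _ _ x'] a show "x = x'" by (auto simp: T2_def)
  qed
  then have c2: "card T2 \<le> card detours"
    using d2 finite_detours by (intro card_inj_on_le) auto
  have "{x \<in> X n - X 0. \<exists>t\<le>n. (x \<in> X t) \<noteq> (g n (e x) \<in> Y t)} = T1 \<union> T2"
    by (auto simp: T1_def T2_def)
  then show ?thesis using card_Un_le[of T1 T2] c1 c2 by simp
qed

end

text \<open>The chains depend only on the common endpoints, and both paths have the same bins
  \<open>Y t\<close>. A ball present at time \<open>t\<close> on only one path therefore disagrees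
  with the final bin of its chain on one of the two.\<close>

lemma two_paths_changes_ge:
  assumes "growing_bijections X Y g n" "growing_bijections X' Y g' n"
    and same: "X 0 = X' 0" "X n = X' n" "g 0 = g' 0" "g n = g' n"
  shows "card {x \<in> X n. \<exists>t\<le>n. x \<in> X t \<and> x \<notin> X' t} + 4 * card {x \<in> X 0. g n x \<noteq> g 0 x}
    \<le> 2 * (\<Sum>i<n. card {x \<in> X i. g (Suc i) x \<noteq> g i x})
      + 2 * (\<Sum>i<n. card {x \<in> X' i. g' (Suc i) x \<noteq> g' i x})"
proof -
  interpret P: growing_bijections X Y g n by fact
  interpret Q: growing_bijections X' Y g' n by fact
  have "\<forall>x\<in>X n - X 0. \<exists>y. (x, y) \<in> P.chain \<and> g n y \<notin> Y 0"
    using links_reach_new[OF P.fin P.X_mono[of 0 n] P.bij[of 0]] P.bij[of n]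
    by (auto simp: bij_betw_def)
  then obtain e where e: "\<And>x. x \<in> X n - X 0 \<Longrightarrow> (x, e x) \<in> P.chain \<and> g n (e x) \<notin> Y 0"
    by metis
  define M where "M = {x \<in> X n - X 0. \<exists>t\<le>n. (x \<in> X t) \<noteq> (g n (e x) \<in> Y t)}"
  define M' where "M' = {x \<in> X' n - X' 0. \<exists>t\<le>n. (x \<in> X' t) \<noteq> (g' n (e x) \<in> Y t)}"
  have "card M \<le> 2 * card P.detours"
    unfolding M_def by (rule P.mismatched_le_detours[OF e])
  moreover have "card M' \<le> 2 * card Q.detours"
    unfolding M'_def by (rule Q.mismatched_le_detours) (use e same in simp)
  moreover have "card {x \<in> X n. \<exists>t\<le>n. x \<in> X t \<and> x \<notin> X' t} \<le> card M + card M'"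
  proof -
    have "{x \<in> X n. \<exists>t\<le>n. x \<in> X t \<and> x \<notin> X' t} \<subseteq> M \<union> M'"
      using Q.X_mono[of 0] same by (fastforce simp: M_def M'_def)
    moreover have "finite (M \<union> M')" using P.fin Q.fin by (simp add: M_def M'_def)
    ultimately have "card {x \<in> X n. \<exists>t\<le>n. x \<in> X t \<and> x \<notin> X' t} \<le> card (M \<union> M')"
      by (intro card_mono)
    then show ?thesis using card_Un_le[of M M'] by simp
  qed
  ultimately show ?thesis
    using P.sum_changes_ge Q.sum_changes_ge same by simp
qed

section \<open>Costs of words of insertions\<close>

fun walk_cost :: "(nat \<Rightarrow> nat \<Rightarrow> (nat + nat) \<Rightarrow> nat) \<Rightarrow> nat \<Rightarrow> nat \<Rightarrow> bool list \<Rightarrow> nat" where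
  "walk_cost f p q [] = 0"
| "walk_cost f p q (True # xs) = step_cost f (p, q) (Suc p, q) + walk_cost f (Suc p) q xs"
| "walk_cost f p q (False # xs) = step_cost f (p, q) (p, Suc q) + walk_cost f p (Suc q) xs"

abbreviation num_True :: "bool list \<Rightarrow> nat" where "num_True xs \<equiv> length (filter id xs)"
abbreviation num_False :: "bool list \<Rightarrow> nat" where "num_False xs \<equiv> length (filter Not xs)"

lemma walk_cost_eq_sum:
  "(\<Sum>k<length xs. step_cost f (p + fst (state xs k), q + snd (state xs k))
      (p + fst (state xs (Suc k)), q + snd (state xs (Suc k)))) = walk_cost f p q xs"
proof (induction xs arbitrary: p q)
  case Nil
  then show ?case by simp
next
  case (Cons x xs)
  have 0: "state ys 0 = (0, 0)" for ys by (simp add: state_def)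
  show ?case
  proof (cases x)
    case True
    have s: "state (True # xs) (Suc k) = (Suc (fst (state xs k)), snd (state xs k))" for k
      by (simp add: state_def)
    show ?thesis
      using Cons[of "Suc p" q] True
      by (simp add: sum.lessThan_Suc_shift s 0 del: sum.lessThan_Suc)
  next
    case False
    have s: "state (False # xs) (Suc k) = (fst (state xs k), Suc (snd (state xs k)))" for k
      by (simp add: state_def)
    show ?thesis
      using Cons[of p "Suc q"] False
      by (simp add: sum.lessThan_Suc_shift s 0 del: sum.lessThan_Suc)
  qed
qed

lemma total_cost_eq_walk_cost: "total_cost f xs = walk_cost f 0 0 xs"
  using walk_cost_eq_sum[where f = f and p = 0 and q = 0 and xs = xs] by (simp add: total_cost_def)

lemma walk_cost_append:
  "walk_cost f p q (xs @ ys) =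
    walk_cost f p q xs + walk_cost f (p + num_True xs) (q + num_False xs) ys"
  by (induction f p q xs rule: walk_cost.induct) auto

lemma walk_cost_concat:
  assumes "P 0 = p" "Q 0 = q"
    and "\<And>t. t < n \<Longrightarrow> P (Suc t) = P t + num_True (w t)"
    and "\<And>t. t < n \<Longrightarrow> Q (Suc t) = Q t + num_False (w t)"
  shows "p + num_True (concat (map w [0..<n])) = P n"
    and "q + num_False (concat (map w [0..<n])) = Q n"
    and "walk_cost f p q (concat (map w [0..<n])) = (\<Sum>t<n. walk_cost f (P t) (Q t) (w t))"
proof -
  have "p + num_True (concat (map w [0..<n])) = P n \<and> q + num_False (concat (map w [0..<n])) = Q n \<and>
    walk_cost f p q (concat (map w [0..<n])) = (\<Sum>t<n. walk_cost f (P t) (Q t) (w t))"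
    using assms by (induction n) (auto simp: walk_cost_append add.assoc[symmetric])
  then show "p + num_True (concat (map w [0..<n])) = P n"
    "q + num_False (concat (map w [0..<n])) = Q n"
    "walk_cost f p q (concat (map w [0..<n])) = (\<Sum>t<n. walk_cost f (P t) (Q t) (w t))"
    by auto
qed

lemma balls_mono: "p \<le> p' \<Longrightarrow> q \<le> q' \<Longrightarrow> balls p q \<subseteq> balls p' q'"
  by (auto simp: balls_def)

lemma finite_balls [simp]: "finite (balls p q)"
  by (simp add: balls_def)

lemma step_cost_triangle:
  assumes "p \<le> p'" "q \<le> q'"
  shows "step_cost f (p, q) s \<le> step_cost f (p, q) (p', q') + step_cost f (p', q') s"
proof -
  let ?g = "f (fst s) (snd s)"
  have "card {x \<in> balls p q. ?g x \<noteq> f p q x} \<le>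
      card ({x \<in> balls p q. f p' q' x \<noteq> f p q x} \<union> {x \<in> balls p' q'. ?g x \<noteq> f p' q' x})"
    using balls_mono[OF assms] by (intro card_mono) auto
  also have "\<dots> \<le> card {x \<in> balls p q. f p' q' x \<noteq> f p q x} + card {x \<in> balls p' q'. ?g x \<noteq> f p' q' x}"
    by (rule card_Un_le)
  finally show ?thesis by (simp add: step_cost_def)
qed

lemma step_cost_le_walk_cost:
  "step_cost f (p, q) (p + num_True xs, q + num_False xs) \<le> walk_cost f p q xs"
proof (induction f p q xs rule: walk_cost.induct)
  case (1 f p q)
  then show ?case by (simp add: step_cost_def)
next
  case (2 f p q xs)
  with step_cost_triangle[of p "Suc p" q q f "(p + num_True (True # xs), q + num_False (True # xs))"]
  show ?case by (simp add: id_def)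
next
  case (3 f p q xs)
  with step_cost_triangle[of p p q "Suc q" f "(p + num_True (False # xs), q + num_False (False # xs))"]
  show ?case by (simp add: id_def)
qed

section \<open>Tilted windows\<close>

definition tilt :: "bool \<Rightarrow> nat \<Rightarrow> nat" where
  "tilt s u = (if s then u + 1 else u - 1)"

text \<open>Insertions of one kind in the first \<open>t\<close> of \<open>2 * H\<close> subwindows,
  up to a common factor. The truncated \<open>t - H\<close> vanishes in the first half.\<close>

definition tilted_sum :: "bool \<Rightarrow> nat \<Rightarrow> nat \<Rightarrow> nat \<Rightarrow> nat" where
  "tilted_sum s H u t = tilt s u * min t H + tilt (\<not> s) u * (t - H)"

lemma tilted_sum_0 [simp]: "tilted_sum s H u 0 = 0"
  by (simp add: tilted_sum_def)

lemma tilted_sum_Suc: "tilted_sum s H u (Suc t) = tilted_sum s H u t + tilt (s = (t < H)) u"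
  by (auto simp: tilted_sum_def min_def Suc_diff_le not_less le_Suc_eq)

lemma tilted_sum_end: "1 \<le> u \<Longrightarrow> tilted_sum s H u (2 * H) = 2 * H * u"
  by (cases u) (auto simp: tilted_sum_def tilt_def min_def algebra_simps)

text \<open>The other kind of insertion has the opposite tilt around \<open>M - u\<close>, so the
  number of bins after \<open>t\<close> subwindows does not depend on the coin.\<close>

lemma tilted_sum_complement:
  assumes "1 \<le> u" "u < M"
  shows "tilted_sum s H u t + tilted_sum (\<not> s) H (M - u) t = M * t"
proof -
  have *: "tilt s u + tilt (\<not> s) (M - u) = M" for s using assms by (auto simp: tilt_def)
  show ?thesis
  proof (induction t)
    case (Suc t)
    have "tilt ((\<not> s) = (t < H)) (M - u) = tilt (\<not> (s = (t < H))) (M - u)" by (cases s) auto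
    with Suc *[of "s = (t < H)"] show ?case by (simp add: tilted_sum_Suc)
  qed simp
qed

lemma tilted_sum_mono: "i \<le> j \<Longrightarrow> tilted_sum s H u i \<le> tilted_sum s H u j"
  by (induction rule: dec_induct) (auto simp: tilted_sum_Suc)

text \<open>The two coin values give paths with equal ends and equal bins at every time, as
  \<open>two_paths_changes_ge\<close> requires. What remains is to count balls present under one
  coin but not yet under the other.\<close>

lemma tilted_windows_cost:
  fixes f p q K H u M
  defines "P \<equiv> \<lambda>s t. p + K * tilted_sum s H u t" and "Q \<equiv> \<lambda>s t. q + K * tilted_sum (\<not> s) H (M - u) t"
  assumes "valid_family f" "1 \<le> u" "u < M"
  shows "(u - 1) * K * (H - u) + 4 * step_cost f (p, q) (p + 2 * H * K * u, q + 2 * H * K * (M - u)) \<le>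
    2 * (\<Sum>s\<in>UNIV. \<Sum>t<2 * H. step_cost f (P s t, Q s t) (P s (Suc t), Q s (Suc t)))"
proof -
  have gb: "growing_bijections (\<lambda>t. balls (P s t) (Q s t)) (\<lambda>t. {1..p + q + K * M * t})
      (\<lambda>t. f (P s t) (Q s t)) (2 * H)" for s
  proof
    fix t t' :: nat
    assume "t \<le> t'"
    then show "balls (P s t) (Q s t) \<subseteq> balls (P s t') (Q s t')"
      unfolding P_def Q_def
      by (intro balls_mono add_left_mono mult_le_mono2 tilted_sum_mono)
    from \<open>t \<le> t'\<close> show "{1..p + q + K * M * t} \<subseteq> {1..p + q + K * M * t'}" by auto
  next
    fix t
    have "P s t + Q s t = p + q + K * M * t"
      using tilted_sum_complement[OF assms(4,5), of s H t]
      by (simp add: P_def Q_def algebra_simps flip: distrib_left)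
    with assms(3) show "bij_betw (f (P s t) (Q s t)) (balls (P s t) (Q s t)) {1..p + q + K * M * t}"
      unfolding valid_family_def by metis
  qed simp
  have start: "P s 0 = p" "Q s 0 = q" for s by (simp_all add: P_def Q_def)
  have fin: "P s (2 * H) = p + 2 * H * K * u" "Q s (2 * H) = q + 2 * H * K * (M - u)" for s
    using assms(4,5) by (simp_all add: P_def Q_def tilted_sum_end)
  let ?A = "{x \<in> balls (P True (2 * H)) (Q True (2 * H)).
    \<exists>t\<le>2 * H. x \<in> balls (P True t) (Q True t) \<and> x \<notin> balls (P False t) (Q False t)}"
  \<comment> \<open>These are the balls that the lower density \<open>u - 1\<close> creates in the
    subwindows with indices \<open>u\<close> to \<open>H - 1\<close>, all in the first half.\<close>
  have "Inl ` {p + (u - 1) * K * u..<p + (u - 1) * K * H} \<subseteq> ?A"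
  proof
    fix x :: "nat + nat"
    assume "x \<in> Inl ` {p + (u - 1) * K * u..<p + (u - 1) * K * H}"
    then obtain m where x: "x = Inl (p + m)" and m: "(u - 1) * K * u \<le> m" "m < (u - 1) * K * H"
      by (auto simp: image_iff) (metis add_diff_inverse_nat add_le_imp_le_left leD le_add1 le_trans
          nat_add_left_cancel_less)
    \<comment> \<open>At time \<open>t\<close> the lower density has just not produced the ball, whereas \<open>t \<ge> u\<close> makes the
      gap between the two densities exceed one subwindow.\<close>
    define t where "t = m div ((u - 1) * K)"
    have pos: "0 < (u - 1) * K" using m by (cases "(u - 1) * K") auto
    have tu: "u \<le> t" using m(1) pos by (simp add: t_def less_eq_div_iff_mult_less_eq mult.commute)
    have tH: "t < H" using m(2) pos by (simp add: t_def div_less_iff_less_mult mult.commute)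
    have lo: "(u - 1) * K * t \<le> m" by (simp add: t_def)
    have "m < (u - 1) * K * Suc t"
      using pos by (simp add: t_def dividend_less_times_div)
    also have "\<dots> \<le> (u + 1) * K * t"
    proof -
      have "(u - 1) * Suc t \<le> (u + 1) * t" using tu by (cases u) (auto simp: algebra_simps)
      then have "K * ((u - 1) * Suc t) \<le> K * ((u + 1) * t)" by (rule mult_le_mono2)
      then show ?thesis by (simp only: mult_ac)
    qed
    finally have hi: "m < (u + 1) * K * t" .
    have "tilted_sum True H u t = (u + 1) * t" "tilted_sum False H u t = (u - 1) * t"
      using tH by (simp_all add: tilted_sum_def tilt_def)
    then have T: "P True t = p + (u + 1) * K * t" "P False t = p + (u - 1) * K * t"
      by (simp_all only: P_def mult_ac)
    have "P True t \<le> P True (2 * H)"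
      using tH by (auto simp: P_def intro!: tilted_sum_mono)
    then have "x \<in> balls (P True (2 * H)) (Q True (2 * H))" "x \<in> balls (P True t) (Q True t)"
      using x hi T by (auto simp: balls_def)
    moreover have "x \<notin> balls (P False t) (Q False t)" using x lo T by (auto simp: balls_def)
    ultimately show "x \<in> ?A" using tH by (auto intro!: exI[of _ t])
  qed
  then have "card (Inl ` {p + (u - 1) * K * u..<p + (u - 1) * K * H} :: (nat + nat) set) \<le> card ?A"
    by (intro card_mono) auto
  then have "(u - 1) * K * (H - u) \<le> card ?A"
    by (simp add: card_image diff_mult_distrib2)
  with two_paths_changes_ge[OF gb[of True] gb[of False]]
  show ?thesis by (simp add: start fin step_cost_def UNIV_bool add.commute add_mult_distrib2)
qed

section \<open>The random instance\<close>

text \<open>\<open>hard_word L u ss\<close> is a window of length \<open>8L (32L)^l\<close> with \<open>u (32L)^l\<close> many \<open>a\<close>-insertions, where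
  \<open>l = length ss\<close>. All windows of one level share the same coin, an entry of \<open>ss\<close>: independence is
  not needed, since only expectations are added up.\<close>

fun hard_word :: "nat \<Rightarrow> nat \<Rightarrow> bool list \<Rightarrow> bool list" where
  "hard_word L u [] = replicate u True @ replicate (8 * L - u) False"
| "hard_word L u (s # ss) =
    concat (map (\<lambda>t. hard_word L (tilt (s = (t < 16 * L)) u) ss) [0..<32 * L])"

lemma num_hard_word:
  assumes "length ss \<le> u" "u + length ss \<le> 8 * L"
  shows "num_True (hard_word L u ss) = u * (32 * L) ^ length ss"
    and "num_False (hard_word L u ss) = (8 * L - u) * (32 * L) ^ length ss"
proof -
  have "num_True (hard_word L u ss) = u * (32 * L) ^ length ss \<and>
    num_False (hard_word L u ss) = (8 * L - u) * (32 * L) ^ length ss"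
    using assms
  proof (induction ss arbitrary: u)
    case Nil
    then show ?case by simp
  next
    case (Cons s ss)
    define K where "K = (32 * L) ^ length ss"
    let ?w = "\<lambda>t. hard_word L (tilt (s = (t < 16 * L)) u) ss"
    have rng: "length ss \<le> tilt b u" "tilt b u + length ss \<le> 8 * L" for b
      using Cons.prems by (auto simp: tilt_def)
    have "8 * L - tilt (s = b) u = tilt ((\<not> s) = b) (8 * L - u)" for b
      using Cons.prems by (auto simp: tilt_def)
    then have n: "num_True (hard_word L (tilt b u) ss) = K * tilt b u"
      "num_False (hard_word L (tilt (s = c) u) ss) = K * tilt ((\<not> s) = c) (8 * L - u)" for b c
      using Cons.IH[OF rng] by (simp_all only: K_def mult.commute)
    have u: "1 \<le> u" "1 \<le> 8 * L - u" using Cons.prems by auto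
    have "0 + num_True (concat (map ?w [0..<32 * L])) = K * tilted_sum s (16 * L) u (32 * L)"
      and "0 + num_False (concat (map ?w [0..<32 * L]))
        = K * tilted_sum (\<not> s) (16 * L) (8 * L - u) (32 * L)"
      by (rule walk_cost_concat[where P = "\<lambda>t. K * tilted_sum s (16 * L) u t"
            and Q = "\<lambda>t. K * tilted_sum (\<not> s) (16 * L) (8 * L - u) t"];
          simp add: tilted_sum_Suc n add_mult_distrib2)+
    with u tilted_sum_end[of u s "16 * L"] tilted_sum_end[of "8 * L - u" "\<not> s" "16 * L"]
    show ?case by (simp add: K_def mult_ac id_def)
  qed
  then show "num_True (hard_word L u ss) = u * (32 * L) ^ length ss"
    "num_False (hard_word L u ss) = (8 * L - u) * (32 * L) ^ length ss" by auto
qed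

lemma sum_lists_Suc:
  fixes h :: "bool list \<Rightarrow> 'a::comm_monoid_add"
  shows "(\<Sum>ss | length ss = Suc l. h ss) = (\<Sum>s\<in>UNIV. \<Sum>ss | length ss = l. h (s # ss))"
proof -
  have fin: "finite {ss::bool list. length ss = l}"
    using finite_lists_length_eq[of "UNIV :: bool set" l] by simp
  have "{ss. length ss = Suc l} = (\<lambda>(s, ss). s # ss) ` (UNIV \<times> {ss::bool list. length ss = l})"
    by (auto simp: length_Suc_conv image_iff)
  moreover have "inj_on (\<lambda>(s, ss). s # ss) (UNIV \<times> {ss::bool list. length ss = l})"
    by (auto simp: inj_on_def)
  ultimately show ?thesis
    using fin by (simp add: sum.reindex sum.cartesian_product case_prod_unfold)
qed

text \<open>Keeping the end-to-end \<open>step_cost\<close> in the bound is what lets the induction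
  run: the sum of these terms over the subwindows is at least, on average, that of the whole window
  plus a gain. Each level adds a fixed fraction of the window length.\<close>

lemma hard_word_cost:
  assumes "valid_family f" "3 * L + l \<le> u" "u + l \<le> 5 * L" "0 < L"
  shows "2 ^ l * (4 * step_cost f (p, q) (p + u * (32 * L) ^ l, q + (8 * L - u) * (32 * L) ^ l)
      + l * L * (32 * L) ^ l) \<le> 4 * (\<Sum>ss | length ss = l. walk_cost f p q (hard_word L u ss))"
  using assms(2,3)
proof (induction l arbitrary: u p q)
  case 0
  then show ?case
    using step_cost_le_walk_cost[of f p q "hard_word L u []"] by simp
next
  case (Suc l)
  define K where "K = (32 * L) ^ l"
  define H where "H = 16 * L"
  define M where "M = 8 * L"
  define P where "P s t = p + K * tilted_sum s H u t" for s t
  define Q where "Q s t = q + K * tilted_sum (\<not> s) H (M - u) t" for s t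
  have u: "1 \<le> u" "u < M" using Suc.prems assms(4) by (auto simp: M_def)
  have rng: "3 * L + l \<le> tilt b u" "tilt b u + l \<le> 5 * L" for b
    using Suc.prems by (auto simp: tilt_def)
  have comp: "M - tilt (s = b) u = tilt ((\<not> s) = b) (M - u)" for s b
    using u by (auto simp: tilt_def)
  define D where "D s t = step_cost f (P s t, Q s t) (P s (Suc t), Q s (Suc t))" for s t
  have IH: "2 ^ l * (4 * D s t + l * L * K)
      \<le> 4 * (\<Sum>ss | length ss = l. walk_cost f (P s t) (Q s t) (hard_word L (tilt (s = (t < H)) u) ss))"
    for s t
  proof -
    have "P s (Suc t) = P s t + tilt (s = (t < H)) u * K"
      "Q s (Suc t) = Q s t + (M - tilt (s = (t < H)) u) * K"
      by (simp_all add: P_def Q_def tilted_sum_Suc comp algebra_simps)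
    with Suc.IH[OF rng, of "P s t" "Q s t" "s = (t < H)"] show ?thesis
      by (simp add: D_def K_def M_def)
  qed
  have wc: "walk_cost f p q (hard_word L u (s # ss))
      = (\<Sum>t<2 * H. walk_cost f (P s t) (Q s t) (hard_word L (tilt (s = (t < H)) u) ss))"
    if "length ss = l" for s ss
  proof -
    have n: "num_True (hard_word L (tilt b u) ss) = tilt b u * K"
      "num_False (hard_word L (tilt b u) ss) = (M - tilt b u) * K" for b
      using num_hard_word[of ss "tilt b u" L] rng[of b] that by (auto simp: K_def M_def)
    have "walk_cost f p q (concat (map (\<lambda>t. hard_word L (tilt (s = (t < H)) u) ss) [0..<2 * H]))
      = (\<Sum>t<2 * H. walk_cost f (P s t) (Q s t) (hard_word L (tilt (s = (t < H)) u) ss))"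
      by (rule walk_cost_concat)
        (simp_all add: P_def Q_def tilted_sum_Suc n comp algebra_simps)
    then show ?thesis by (simp add: H_def)
  qed
  have gain: "32 * L * L * K + 4 * step_cost f (p, q) (p + 2 * H * K * u, q + 2 * H * K * (M - u))
      \<le> 2 * (\<Sum>s\<in>UNIV. \<Sum>t<2 * H. D s t)"
  proof -
    \<comment> \<open>Here \<open>3 * L < u < 5 * L\<close>, so the factors are at least
      \<open>3 * L\<close> and \<open>16 * L - 5 * L\<close>.\<close>
    have "3 * L * (11 * L) \<le> (u - 1) * (H - u)"
      using Suc.prems by (intro mult_le_mono) (auto simp: H_def)
    then have "32 * L * L \<le> (u - 1) * (H - u)" by simp
    then have "32 * L * L * K \<le> (u - 1) * (H - u) * K" by (rule mult_le_mono1)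
    also have "\<dots> = (u - 1) * K * (H - u)" by (simp only: mult_ac)
    finally have "32 * L * L * K \<le> (u - 1) * K * (H - u)" .
    moreover have "(u - 1) * K * (H - u)
        + 4 * step_cost f (p, q) (p + 2 * H * K * u, q + 2 * H * K * (M - u))
        \<le> 2 * (\<Sum>s\<in>UNIV. \<Sum>t<2 * H. D s t)"
      unfolding D_def P_def Q_def by (rule tilted_windows_cost[OF assms(1) u])
    ultimately show ?thesis by linarith
  qed
  \<comment> \<open>The new coin doubles the number of sequences. One of the \<open>Suc l\<close>
    units is paid by \<open>gain\<close>, the others are spread over the \<open>2 * H\<close>
    subwindows.\<close>
  have "2 ^ Suc l * (4 * step_cost f (p, q) (p + u * (32 * L) ^ Suc l, q + (8 * L - u) * (32 * L) ^ Suc l)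
      + Suc l * L * (32 * L) ^ Suc l)
    = 2 ^ l * (2 * (32 * L * L * K + 4 * step_cost f (p, q) (p + 2 * H * K * u, q + 2 * H * K * (M - u)))
      + 2 * (2 * H * (l * L * K)))"
    by (simp add: K_def H_def M_def algebra_simps)
  also have "\<dots> \<le> 2 ^ l * (4 * (\<Sum>s\<in>UNIV. \<Sum>t<2 * H. D s t) + 2 * (2 * H * (l * L * K)))"
    using gain by (intro mult_le_mono2) simp
  also have "\<dots> = (\<Sum>s\<in>UNIV. \<Sum>t<2 * H. 2 ^ l * (4 * D s t + l * L * K))"
    by (simp add: UNIV_bool sum.distrib sum_distrib_left algebra_simps)
  also have "\<dots> \<le> (\<Sum>s\<in>UNIV. \<Sum>t<2 * H. 4 * (\<Sum>ss | length ss = l.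
      walk_cost f (P s t) (Q s t) (hard_word L (tilt (s = (t < H)) u) ss)))"
    by (intro sum_mono IH)
  also have "\<dots> = 4 * (\<Sum>s\<in>UNIV. \<Sum>ss | length ss = l. walk_cost f p q (hard_word L u (s # ss)))"
    unfolding sum_distrib_left
    by (intro sum.cong refl, subst sum.swap) (simp add: wc sum_distrib_left del: hard_word.simps)
  also have "\<dots> = 4 * (\<Sum>ss | length ss = Suc l. walk_cost f p q (hard_word L u ss))"
    by (simp add: sum_lists_Suc)
  finally show ?case .
qed

text \<open>A balanced window with \<open>L\<close> levels has \<open>4 * L * (32 * L) ^ L\<close>
  insertions of each kind, hence the divisor. The padding brings both counts to
  \<open>n\<close>.\<close>

definition hard_instance :: "nat \<Rightarrow> nat \<Rightarrow> bool list \<Rightarrow> bool list" where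
  "hard_instance n L ss =
    (let R = n div (4 * L * (32 * L) ^ L); r = n mod (4 * L * (32 * L) ^ L)
     in concat (map (\<lambda>_. hard_word L (4 * L) ss) [0..<R]) @ replicate r True @ replicate r False)"

lemma num_copies:
  assumes "length ss = L"
  defines "a \<equiv> 4 * L * (32 * L) ^ L"
  shows "num_True (concat (map (\<lambda>_. hard_word L (4 * L) ss) [0..<R])) = R * a"
    and "num_False (concat (map (\<lambda>_. hard_word L (4 * L) ss) [0..<R])) = R * a"
    and "walk_cost f 0 0 (concat (map (\<lambda>_. hard_word L (4 * L) ss) [0..<R]))
      = (\<Sum>t<R. walk_cost f (t * a) (t * a) (hard_word L (4 * L) ss))"
proof -
  have n: "num_True (hard_word L (4 * L) ss) = a" "num_False (hard_word L (4 * L) ss) = a"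
    using num_hard_word[of ss "4 * L" L] assms by auto
  note * = walk_cost_concat[where P = "\<lambda>t. t * a" and Q = "\<lambda>t. t * a" and p = 0 and q = 0 and n = R
      and w = "\<lambda>_. hard_word L (4 * L) ss", simplified n]
  show "num_True (concat (map (\<lambda>_. hard_word L (4 * L) ss) [0..<R])) = R * a"
    "num_False (concat (map (\<lambda>_. hard_word L (4 * L) ss) [0..<R])) = R * a"
    "walk_cost f 0 0 (concat (map (\<lambda>_. hard_word L (4 * L) ss) [0..<R]))
      = (\<Sum>t<R. walk_cost f (t * a) (t * a) (hard_word L (4 * L) ss))"
    using * by auto
qed

lemma valid_hard_instance:
  assumes "length ss = L"
  shows "valid_instance n (hard_instance n L ss)"
proof -
  have len: "length xs = num_True xs + num_False xs" for xs
    using sum_length_filter_compl[of id xs] by simp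
  have "num_True (hard_instance n L ss) = n" "num_False (hard_instance n L ss) = n"
    using num_copies[OF assms] by (simp_all add: hard_instance_def Let_def div_mult_mod_eq)
  then show ?thesis using len[of "hard_instance n L ss"] by (simp add: valid_instance_def)
qed

lemma hard_instance_cost:
  assumes "valid_family f" "0 < L" "4 * L * (32 * L) ^ L \<le> n"
  shows "2 ^ L * (n * L) \<le> 32 * (\<Sum>ss | length ss = L. total_cost f (hard_instance n L ss))"
proof -
  define a where "a = 4 * L * (32 * L) ^ L"
  define R where "R = n div a"
  have "0 < a" using assms(2) by (simp add: a_def)
  then have "1 \<le> R" using assms(3) by (simp add: R_def a_def less_eq_div_iff_mult_less_eq)
  \<comment> \<open>At least one whole window fits, so whole windows fill at least half of the
    instance.\<close>
  have "n < a * Suc R" using \<open>0 < a\<close> by (simp add: R_def dividend_less_times_div)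
  also have "\<dots> \<le> 2 * (R * a)" using \<open>1 \<le> R\<close> by (simp add: algebra_simps)
  finally have n: "n \<le> 2 * (R * a)" by simp
  have "2 ^ L * (n * L) \<le> 2 ^ L * (2 * (R * a) * L)"
    using n by (intro mult_le_mono) auto
  also have "\<dots> = 8 * (\<Sum>t<R. 2 ^ L * (L * L * (32 * L) ^ L))"
    by (simp add: a_def algebra_simps)
  also have "\<dots> \<le> 8 * (\<Sum>t<R. 4 * (\<Sum>ss | length ss = L. walk_cost f (t * a) (t * a) (hard_word L (4 * L) ss)))"
  proof (intro mult_le_mono2 sum_mono)
    fix t
    show "2 ^ L * (L * L * (32 * L) ^ L)
        \<le> 4 * (\<Sum>ss | length ss = L. walk_cost f (t * a) (t * a) (hard_word L (4 * L) ss))"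
      using hard_word_cost[OF assms(1), of L L "4 * L" "t * a" "t * a"] assms(2)
      by (simp add: add_mult_distrib2)
  qed
  also have "\<dots> = 32 * (\<Sum>ss | length ss = L. \<Sum>t<R. walk_cost f (t * a) (t * a) (hard_word L (4 * L) ss))"
    by (subst sum.swap) (simp add: sum_distrib_left)
  also have "\<dots> \<le> 32 * (\<Sum>ss | length ss = L. total_cost f (hard_instance n L ss))"
  proof (intro mult_le_mono2 sum_mono)
    fix ss :: "bool list"
    assume "ss \<in> {ss. length ss = L}"
    then show "(\<Sum>t<R. walk_cost f (t * a) (t * a) (hard_word L (4 * L) ss))
        \<le> total_cost f (hard_instance n L ss)"
      using num_copies(3)[of ss L f R]
      by (simp add: total_cost_eq_walk_cost hard_instance_def Let_def walk_cost_append R_def a_def)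
  qed
  finally show ?thesis .
qed

section \<open>Choice of the number of levels\<close>

text \<open>With \<open>L\<close> the integer part of \<open>ln n / (4 * ln (ln n))\<close>,
  \<open>32 * L \<le> ln n\<close> yields \<open>(32 * L) ^ L \<le> n powr (1/4)\<close>, leaving
  room for the factor \<open>4 * L\<close>. Rounding down loses at most a factor 2, hence the
  8.\<close>

lemma eventually_levels:
  "eventually (\<lambda>n::nat. \<exists>L>0. 4 * L * (32 * L) ^ L \<le> n \<and>
    real L \<ge> ln (real n) / (8 * ln (ln (real n)))) at_top"
proof -
  have "eventually (\<lambda>n::nat. ln (real n) / (4 * ln (ln (real n))) \<ge> 1) at_top" by real_asymp
  moreover have "eventually (\<lambda>n::nat. ln (ln (real n)) \<ge> 8) at_top" by real_asymp
  moreover have "eventually (\<lambda>n::nat. ln (real n) * real n powr (1/4) \<le> real n) at_top" by real_asymp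
  moreover have "eventually (\<lambda>n::nat. ln (real n) \<ge> 1) at_top" by real_asymp
  ultimately show ?thesis
  proof eventually_elim
    case (elim n)
    define x where "x = ln (real n) / (4 * ln (ln (real n)))"
    define L where "L = nat \<lfloor>x\<rfloor>"
    have "x \<ge> 1" using elim by (simp add: x_def)
    have L: "real L \<le> x" "x < real L + 1" "L > 0"
      using \<open>x \<ge> 1\<close> by (auto simp: L_def)
    have "n > 0" using elim(4) by (cases n) auto
    have "32 * x = ln (real n) * (8 / ln (ln (real n)))" by (simp add: x_def)
    also have "\<dots> \<le> ln (real n) * 1"
      using elim by (intro mult_left_mono) (auto simp: divide_le_eq)
    finally have "32 * x \<le> ln (real n)" by simp
    then have L32: "32 * real L \<le> ln (real n)" using L by simp
    have "(32 * real L) ^ L \<le> ln (real n) ^ L" using L32 by (intro power_mono) auto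
    also have "\<dots> = exp (real L * ln (ln (real n)))"
      using elim by (simp add: exp_of_nat_mult)
    also have "\<dots> \<le> exp (x * ln (ln (real n)))"
      using L elim by (simp add: mult_right_mono)
    also have "\<dots> = real n powr (1/4)"
      using elim \<open>n > 0\<close> by (simp add: x_def powr_def)
    finally have "4 * real L * (32 * real L) ^ L \<le> ln (real n) * real n powr (1/4)"
      using L32 elim by (intro mult_mono) auto
    also have "\<dots> \<le> real n" by (rule elim)
    finally have "real (4 * L * (32 * L) ^ L) \<le> real n" by simp
    then have "4 * L * (32 * L) ^ L \<le> n" by (simp only: of_nat_le_iff)
    moreover have "ln (real n) / (8 * ln (ln (real n))) = x / 2" by (simp add: x_def)
    moreover have "x / 2 \<le> real L" using L by linarith
    ultimately show ?case using L by auto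
  qed
qed

theorem theorem6p1:
  shows "\<exists>c::real. c > 0 \<and> (\<exists>N::nat. \<forall>n\<ge>N. \<exists>D :: bool list pmf.
           set_pmf D \<subseteq> {xs. valid_instance n xs} \<and>
           (\<forall>f. valid_family f \<longrightarrow>
              measure_pmf.expectation D (\<lambda>xs. real (total_cost f xs))
                \<ge> c * real n * ln (real n) / ln (ln (real n))))"
proof -
  obtain N where N: "\<And>n. n \<ge> N \<Longrightarrow> \<exists>L>0. 4 * L * (32 * L) ^ L \<le> n \<and>
    real L \<ge> ln (real n) / (8 * ln (ln (real n)))"
    using eventually_levels unfolding eventually_at_top_linorder by blast
  show ?thesis
  \<comment> \<open>The constant is \<open>1 / 8\<close> from the choice of \<open>L\<close> times
    \<open>1 / 32\<close> from \<open>hard_instance_cost\<close>.\<close>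
  proof (intro exI[of _ "1 / 256"] conjI exI[of _ N] allI impI)
    fix n assume "n \<ge> N"
    then obtain L where L: "0 < L" "4 * L * (32 * L) ^ L \<le> n"
      "real L \<ge> ln (real n) / (8 * ln (ln (real n)))"
      using N by blast
    define C where "C = {ss :: bool list. length ss = L}"
    have C: "finite C" "C \<noteq> {}" "card C = 2 ^ L"
      using finite_lists_length_eq[of "UNIV :: bool set" L]
        card_lists_length_eq[of "UNIV :: bool set" L] Ex_list_of_length[of L]
      by (auto simp: C_def)
    define D where "D = map_pmf (hard_instance n L) (pmf_of_set C)"
    show "\<exists>D :: bool list pmf. set_pmf D \<subseteq> {xs. valid_instance n xs} \<and>
       (\<forall>f. valid_family f \<longrightarrow> 1 / 256 * real n * ln (real n) / ln (ln (real n))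
          \<le> measure_pmf.expectation D (\<lambda>xs. real (total_cost f xs)))"
    proof (intro exI[of _ D] conjI allI impI)
      show "set_pmf D \<subseteq> {xs. valid_instance n xs}"
        using C valid_hard_instance by (auto simp: D_def C_def)
      fix f assume f: "valid_family f"
      have "1 / 256 * real n * ln (real n) / ln (ln (real n))
          = real n * (ln (real n) / (8 * ln (ln (real n)))) / 32" by simp
      also have "\<dots> \<le> real n * real L / 32"
        using L(3) by (intro divide_right_mono mult_left_mono) auto
      also have "\<dots> \<le> (\<Sum>ss\<in>C. real (total_cost f (hard_instance n L ss))) / 2 ^ L"
      proof -
        have "real (2 ^ L * (n * L)) \<le> real (32 * (\<Sum>ss\<in>C. total_cost f (hard_instance n L ss)))"
          using hard_instance_cost[OF f L(1,2)] unfolding C_def by (simp only: of_nat_le_iff)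
        then show ?thesis by (simp add: field_simps)
      qed
      also have "\<dots> = measure_pmf.expectation D (\<lambda>xs. real (total_cost f xs))"
        using C by (simp add: D_def integral_pmf_of_set)
      finally show "1 / 256 * real n * ln (real n) / ln (ln (real n))
          \<le> measure_pmf.expectation D (\<lambda>xs. real (total_cost f xs))" .
    qed
  qed simp
qed

end
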